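(* Let $n\ge2$. The local isometry moduli space of $n$-dimensional strongly convex Randers spaces of constant flag curvature $K=0$ is parametrized by $a=(a_1,\dots,a_m)\in\mathbb R^m$ as follows; that is, $a\mapsto[W_a]$ is a bijection from the stated parameter space onto the moduli space. (i) When $n$ is even, $m=n/2$ and the parameter space is the disjoint union of $$\{a_1\ge\cdots\ge a_m\ge0\}\qquad\text{and}\qquad\{1>a_1>0,\ a_2\ge\cdots\ge a_m\ge0\}.$$ (ii) When $n$ is odd, $m=(n+1)/2$ and the parameter space is given by $1>a_1\ge0$, $a_2\ge\cdots\ge a_m\ge0$. (iii) The globally defined metrics (the classes for which strong convexity $|W|<1$ holds on all of $\mathbb R^n$) are parametrized by $1>a_1\ge0$, $a_2=\cdots=a_m=0$.
   Context: A strongly convex Randers metric is a Finsler metric $F=\sqrt{a_{ij}y^iy^j}+b_iy^i$ with $a^{ij}b_ib_j<1$; it corresponds uniquely to navigation data $(h,W)$, $h$ a Riemannian metric and $W$ a vector field with $|W|^2=h(W,W)<1$, via $a_{ij}=\frac{h_{ij}}\lambda+\frac{W_iW_j}{\lambda^2}$, $b_i=-\frac{W_i}\lambda$, $W_i=h_{ij}W^j$, $\lambda=1-|W|^2$. Constant flag curvature $K=0$ holds exactly when, up to local isometry, $h=h_0$ is the Euclidean metric on $\mathbb R^n$ and $W$ is a Killing field $W(x)=Qx+C$, with $Q$ a constant skew-symmetric matrix and $C$ a constant vector. The moduli space is defined as follows. Consider all Killing fields $W=Qx+C$ of $(\mathbb R^n,h_0)$ such that $|W|<1$ on some nonempty open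 subset of $\mathbb R^n$. The isometry group $G=E(n)$ of $\mathbb R^n$ (rotations, reflections, translations) acts by push-forward $W\mapsto\phi_*W$. The moduli space is the set of $G$-orbits $[W]$ of such $W$; it represents local isometry classes of strongly convex Randers metrics of zero flag curvature. With $J=\begin{pmatrix}0&1\\-1&0\end{pmatrix}$, the normal forms $W_a=Qx+C$ are as follows. For $n$ even and $a$ in the first set: $-Q=a_1J\oplus\cdots\oplus a_mJ$ and $C=0$. For $n$ even and $a$ in the second set: $-Q=a_2J\oplus\cdots\oplus a_mJ\oplus 0_{2}$ (with $0_2$ the $2\times2$ zero matrix) and $C=(0,\dots,0,a_1)$. For $n$ odd: $-Q=a_2J\oplus\cdots\oplus a_mJ\oplus0$ and $C=(0,\dots,0,a_1)$. In (iii) with $n$ even, $a_1>0$ refers to the second set and $a_1=0$ to the point $a=0$ of the first set. *)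

theory Defs
  imports "HOL-Analysis.Analysis"
begin

text \<open>A strongly convex Randers metric of zero flag curvature is given locally by navigation
  data consisting of the Euclidean metric and a Killing field \<open>W\<close>; strong convexity at \<open>x\<close> is
  \<open>norm (W x) < 1\<close>. The moduli space is the set of orbits of such \<open>W\<close> under Euclidean
  isometries, acting by push-forward. Killing fields are taken in the form \<open>Q x + C\<close>.\<close>

definition killing_fields :: "(real^'n \<Rightarrow> real^'n) set" where
  "killing_fields = {W. \<exists>Q C. transpose Q = - Q \<and> W = (\<lambda>x. Q *v x + C)}"

definition admissible_fields :: "(real^'n \<Rightarrow> real^'n) set" where
  "admissible_fields =
     {W \<in> killing_fields. \<exists>U. open U \<and> U \<noteq> {} \<and> (\<forall>x\<in>U. norm (W x) < 1)}"

definition isometry_group :: "(real^'n \<Rightarrow> real^'n) set" where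
  "isometry_group = {\<phi>. bij \<phi> \<and> (\<forall>x y. dist (\<phi> x) (\<phi> y) = dist x y)}"

definition push_forward ::
    "(real^'n \<Rightarrow> real^'n) \<Rightarrow> (real^'n \<Rightarrow> real^'n) \<Rightarrow> real^'n \<Rightarrow> real^'n" where
  "push_forward \<phi> W = (\<lambda>y. frechet_derivative \<phi> (at (inv \<phi> y)) (W (inv \<phi> y)))"

definition isometry_orbit :: "(real^'n \<Rightarrow> real^'n) \<Rightarrow> (real^'n \<Rightarrow> real^'n) set" where
  "isometry_orbit W = (\<lambda>\<phi>. push_forward \<phi> W) ` isometry_group"

definition moduli_space :: "(real^'n \<Rightarrow> real^'n) set set" where
  "moduli_space = isometry_orbit ` admissible_fields"

text \<open>The condition is constant on orbits, isometries being surjective and their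
  differentials orthogonal.\<close>

definition global_moduli_space :: "(real^'n \<Rightarrow> real^'n) set set" where
  "global_moduli_space = {c \<in> moduli_space. \<forall>W\<in>c. \<forall>x. norm (W x) < 1}"

text \<open>Below, \<open>e\<close> is a bijection from the index type \<open>'n\<close> onto \<open>{1..CARD('n)}\<close>, numbering the
  coordinates. The matrix \<open>J_sum e k c\<close> is \<open>c\<^sub>1 J \<oplus> \<dots> \<oplus> c\<^sub>k J \<oplus> 0\<close>, where \<open>J\<close> has rows
  \<open>(0, 1)\<close> and \<open>(-1, 0)\<close> and the last zero block has size \<open>CARD('n) - 2 k\<close>.\<close>

definition J_sum :: "('n::finite \<Rightarrow> nat) \<Rightarrow> nat \<Rightarrow> (nat \<Rightarrow> real) \<Rightarrow> real^'n^'n" where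
  "J_sum e k c = (\<chi> i j. \<Sum>l=1..k.
     c l * (if e i = 2 * l - 1 \<and> e j = 2 * l then 1
            else if e i = 2 * l \<and> e j = 2 * l - 1 then -1 else 0))"

text \<open>Vectors of \<open>\<real>\<^sup>m\<close> are represented by the functions in \<open>extensional {1..m}\<close>.\<close>

definition linear_form ::
    "('n::finite \<Rightarrow> nat) \<Rightarrow> nat \<Rightarrow> (nat \<Rightarrow> real) \<Rightarrow> real^'n \<Rightarrow> real^'n" where
  "linear_form e m a = (\<lambda>x. (- J_sum e m a) *v x)"

definition affine_form ::
    "('n::finite \<Rightarrow> nat) \<Rightarrow> nat \<Rightarrow> (nat \<Rightarrow> real) \<Rightarrow> real^'n \<Rightarrow> real^'n" where
  "affine_form e m a = (\<lambda>x. (- J_sum e (m - 1) (\<lambda>l. a (l + 1))) *v x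
     + (\<chi> i. if e i = CARD('n) then a 1 else 0))"

text \<open>For even dimension the parameter space is a disjoint union of two subsets of \<open>\<real>\<^sup>m\<close> that
  overlap as sets, so it lives in the sum type.\<close>

definition normal_form_even ::
    "('n::finite \<Rightarrow> nat) \<Rightarrow> nat \<Rightarrow> (nat \<Rightarrow> real) + (nat \<Rightarrow> real) \<Rightarrow> real^'n \<Rightarrow> real^'n" where
  "normal_form_even e m = case_sum (linear_form e m) (affine_form e m)"

definition nonneg_decreasing_on :: "nat set \<Rightarrow> (nat \<Rightarrow> real) \<Rightarrow> bool" where
  "nonneg_decreasing_on I a \<longleftrightarrow> antimono_on I a \<and> (\<forall>i\<in>I. 0 \<le> a i)"

definition params_even :: "nat \<Rightarrow> ((nat \<Rightarrow> real) + (nat \<Rightarrow> real)) set" where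
  "params_even m =
     {a \<in> extensional {1..m}. nonneg_decreasing_on {1..m} a} <+>
     {a \<in> extensional {1..m}. 0 < a 1 \<and> a 1 < 1 \<and> nonneg_decreasing_on {2..m} a}"

definition params_odd :: "nat \<Rightarrow> (nat \<Rightarrow> real) set" where
  "params_odd m =
     {a \<in> extensional {1..m}. 0 \<le> a 1 \<and> a 1 < 1 \<and> nonneg_decreasing_on {2..m} a}"

definition global_params_even :: "nat \<Rightarrow> ((nat \<Rightarrow> real) + (nat \<Rightarrow> real)) set" where
  "global_params_even m =
     {a \<in> extensional {1..m}. \<forall>i\<in>{1..m}. a i = 0} <+>
     {a \<in> extensional {1..m}. 0 < a 1 \<and> a 1 < 1 \<and> (\<forall>i\<in>{2..m}. a i = 0)}"

definition global_params_odd :: "nat \<Rightarrow> (nat \<Rightarrow> real) set" where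
  "global_params_odd m =
     {a \<in> extensional {1..m}. 0 \<le> a 1 \<and> a 1 < 1 \<and> (\<forall>i\<in>{2..m}. a i = 0)}"

end

theory Submission
  imports Defs
begin

text \<open>Write a Killing field as \<open>W x = Q x + C\<close>. The range of the skew matrix \<open>Q\<close> is the orthogonal
  complement of its kernel, so \<open>C = Q v + D\<close> with \<open>D\<close> in the kernel, and after a translation
  \<open>W x = Q x + D\<close>. Here \<open>D\<close> is orthogonal to \<open>Q x\<close>, whence \<open>norm D\<close> is the minimum of
  \<open>norm (W x)\<close>: the field is admissible exactly when \<open>norm D < 1\<close>, and \<open>norm D\<close> is an invariant
  of the orbit.

  Existence of a normal form is then linear algebra. A skew endomorphism is an orthogonal sum of
  multiples of the rotation generator and of zero (\<open>skew_normal_basis\<close>). If \<open>D = 0\<close> this is applied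
  to the whole space; if \<open>D \<noteq> 0\<close> it is applied to the complement of \<open>D\<close>, and the direction of
  \<open>D\<close> becomes the last basis vector. The number of blocks is thus \<open>n div 2\<close> or \<open>(n - 1) div 2\<close>.
  For odd \<open>n\<close> the two numbers agree and the cases merge into one family with \<open>0 \<le> a\<^sub>1 < 1\<close>; for
  even \<open>n\<close> they differ, which is why the parameter space has two parts.

  For uniqueness, an isometry between two fields conjugates the linear parts by an orthogonal map.
  For \<open>t \<ge> 0\<close> the eigenspace of \<open>Q\<^sup>2\<close> for \<open>- t\<^sup>2\<close> has dimension twice the number of
  blocks with coefficient \<open>t\<close> (plus a fixed amount for \<open>t = 0\<close>), so the multiplicities, and hence
  the decreasing sequence of coefficients, are determined by the orbit. Finally, \<open>W\<close> is bounded by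
  \<open>1\<close> everywhere only if its linear part vanishes.

  Both families of normal forms are instances of \<open>block_field\<close>, for which all of this is
  proved; \<open>moduli_spaces_bij_betw\<close> turns it into bijections.\<close>

section \<open>Normal form of a skew endomorphism\<close>

lemma skew_sym_square:
  fixes f :: "'a::real_inner \<Rightarrow> 'a"
  assumes "\<And>x y. f x \<bullet> y = - (x \<bullet> f y)"
  shows "f x \<bullet> x = 0"
  using assms[of x x] by (simp add: inner_commute)

text \<open>Near \<open>s = 0\<close> a nonzero linear term would dominate and change sign. Applied along the lines through a
  maximum, this gives the first order condition there.\<close>

lemma nonneg_quadratic_linear_term_zero:
  fixes a b :: real
  assumes "\<And>s::real. 0 \<le> 2 * s * b + s\<^sup>2 * a"
  shows "b = 0"
proof (rule ccontr)
  assume "b \<noteq> 0"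
  define k where "k = \<bar>a\<bar> + 1"
  have k: "k > 0" "a \<le> k"
    by (auto simp: k_def)
  have "0 \<le> 2 * (- b / k) * b + (- b / k)\<^sup>2 * a"
    by (rule assms)
  also have "\<dots> \<le> 2 * (- b / k) * b + (- b / k)\<^sup>2 * k"
    using k by (intro add_left_mono mult_left_mono) auto
  also have "\<dots> = - (b\<^sup>2 / k)"
    using k by (simp add: field_simps power2_eq_square)
  also have "\<dots> < 0"
    using k \<open>b \<noteq> 0\<close> by simp
  finally show False
    by simp
qed

text \<open>Let \<open>u\<close> maximize \<open>norm (f u)\<close> on the unit sphere of \<open>S\<close>, with maximum \<open>t\<close>. The first order condition
  is \<open>f (f u) = - t\<^sup>2 u\<close>, so \<open>u\<close> and \<open>f u / t\<close> span an invariant plane; for \<open>t = 0\<close>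
  the map vanishes on \<open>S\<close> and every plane through \<open>u\<close> will do. Taking the maximum, not just any
  eigenvector of \<open>f \<circ> f\<close>, makes the coefficients of successive planes decrease.\<close>

lemma skew_maximal_plane:
  fixes f :: "'a::euclidean_space \<Rightarrow> 'a"
  assumes lin: "linear f" and skew: "\<And>x y. f x \<bullet> y = - (x \<bullet> f y)"
    and S: "subspace S" "f ` S \<subseteq> S" "dim S \<ge> 2"
  obtains t u v where "0 \<le> t" "u \<in> S" "v \<in> S" "norm u = 1" "norm v = 1" "u \<bullet> v = 0"
    "f u = t *\<^sub>R v" "f v = - t *\<^sub>R u" "\<And>x. x \<in> S \<Longrightarrow> norm (f x) \<le> t * norm x"
proof -
  interpret linear f by (rule lin)
  let ?K = "S \<inter> sphere 0 1"
  have unit: "\<exists>u. u \<in> T \<and> norm u = 1" if T: "subspace T" "dim T \<ge> 1" for T :: "'a set"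
  proof -
    obtain z where "z \<in> T" "z \<noteq> 0"
      using T by (metis dim_eq_0 not_one_le_zero singleton_iff subsetI)
    then show ?thesis
      using T by (intro exI[of _ "z /\<^sub>R norm z"]) (auto simp: subspace_scale)
  qed
  have "compact ?K"
    using S by (simp add: closed_subspace closed_Int_compact)
  moreover have "?K \<noteq> {}"
    using unit[of S] S by auto
  moreover have "continuous_on ?K (\<lambda>x. norm (f x))"
    using lin by (intro continuous_on_norm linear_continuous_on) (simp add: linear_conv_bounded_linear)
  ultimately obtain u where u: "u \<in> ?K" and max: "\<And>x. x \<in> ?K \<Longrightarrow> norm (f x) \<le> norm (f u)"
    using continuous_attains_sup[of ?K "\<lambda>x. norm (f x)"] by metis
  define t where "t = norm (f u)"
  have uS: "u \<in> S" and u1: "norm u = 1" and fS: "\<And>x. x \<in> S \<Longrightarrow> f x \<in> S"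
    using u S by auto
  have bound: "norm (f x) \<le> t * norm x" if "x \<in> S" for x
  proof (cases "x = 0")
    case False
    have "norm (f (x /\<^sub>R norm x)) \<le> t"
      unfolding t_def using False that S by (intro max) (auto simp: subspace_scale)
    then show ?thesis
      using False by (simp add: scale field_simps)
  qed (simp add: zero)
  \<comment> \<open>First order condition at the maximum: the form \<open>t\<^sup>2 (x \<bullet> y) - f x \<bullet> f y\<close> is positive
      semidefinite on \<open>S\<close> and isotropic at \<open>u\<close>, so \<open>u\<close> lies in its radical.\<close>
  have radical: "t\<^sup>2 * (u \<bullet> x) - f u \<bullet> f x = 0" if x: "x \<in> S" for x
  proof (rule nonneg_quadratic_linear_term_zero[where a = "t\<^sup>2 * (x \<bullet> x) - f x \<bullet> f x"])
    fix s :: real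
    have "u + s *\<^sub>R x \<in> S"
      using x uS S by (simp add: subspace_add subspace_scale)
    then have "(norm (f (u + s *\<^sub>R x)))\<^sup>2 \<le> (t * norm (u + s *\<^sub>R x))\<^sup>2"
      by (intro power_mono bound) auto
    then have "f (u + s *\<^sub>R x) \<bullet> f (u + s *\<^sub>R x) \<le> t\<^sup>2 * ((u + s *\<^sub>R x) \<bullet> (u + s *\<^sub>R x))"
      by (simp add: power_mult_distrib power2_norm_eq_inner)
    moreover have "f u \<bullet> f u = t\<^sup>2" "u \<bullet> u = 1"
      using u1 by (simp_all add: t_def power2_norm_eq_inner norm_eq_1)
    ultimately show "0 \<le> 2 * s * (t\<^sup>2 * (u \<bullet> x) - f u \<bullet> f x)
        + s\<^sup>2 * (t\<^sup>2 * (x \<bullet> x) - f x \<bullet> f x)"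
      by (simp add: add scale inner_add_left inner_add_right inner_commute power2_eq_square algebra_simps)
  qed
  have ffu: "f (f u) = - t\<^sup>2 *\<^sub>R u"
  proof -
    let ?z = "t\<^sup>2 *\<^sub>R u + f (f u)"
    have "?z \<in> S"
      using uS fS S by (simp add: subspace_add subspace_scale)
    then have "t\<^sup>2 * (u \<bullet> ?z) - f u \<bullet> f ?z = 0"
      by (rule radical)
    then have "?z \<bullet> ?z = 0"
      using skew[of "f u" ?z] by (simp add: inner_add_left)
    then show ?thesis
      by (simp add: eq_neg_iff_add_eq_0 add.commute)
  qed
  show ?thesis
  proof (cases "t = 0")
    case True
    have "dim {y \<in> S. \<forall>x\<in>span {u}. orthogonal x y} + dim (span {u}) = dim S"
      using uS S by (intro dim_subspace_orthogonal_to_vectors) (auto simp: span_minimal)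
    moreover have "dim (span {u}) \<le> 1"
      using dim_le_card[of "span {u}" "{u}"] by simp
    ultimately have "dim {y \<in> S. \<forall>x\<in>span {u}. orthogonal x y} \<ge> 1"
      using S by linarith
    moreover have "subspace {y \<in> S. \<forall>x\<in>span {u}. orthogonal x y}"
      using S by (auto simp: subspace_def orthogonal_def inner_add_right)
    ultimately obtain v where v: "v \<in> S" "\<forall>x\<in>span {u}. orthogonal x v" "norm v = 1"
      using unit by blast
    have "f u = 0" "f v = 0"
      using bound[of u] bound[of v] uS v True by auto
    with v show ?thesis
      using that[of 0 u v] uS u1 bound True by (auto simp: orthogonal_def span_base)
  next
    case False
    then have "t > 0"
      by (simp add: t_def)
    show ?thesis
    proof (rule that[of t u "f u /\<^sub>R t"])
      show "norm (f u /\<^sub>R t) = 1"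
        using \<open>t > 0\<close> by (simp add: t_def)
      show "u \<bullet> (f u /\<^sub>R t) = 0"
        using skew_sym_square[OF skew, of u] by (simp add: inner_commute)
      show "f (f u /\<^sub>R t) = - t *\<^sub>R u"
        using \<open>t > 0\<close> by (simp add: scale ffu power2_eq_square)
    qed (use \<open>t > 0\<close> uS u1 fS S bound in \<open>auto simp: subspace_scale\<close>)
  qed
qed

text \<open>Split off a maximal plane and continue in its orthogonal complement inside \<open>S\<close>, which is again
  invariant because \<open>f\<close> is skew. The coefficients on the complement are at most that of the plane, as
  the plane attains the norm of \<open>f\<close> on \<open>S\<close>. A line left over at the end is killed by \<open>f\<close>.\<close>

lemma skew_normal_basis:
  fixes f :: "'a::euclidean_space \<Rightarrow> 'a"
  assumes lin: "linear f" and skew: "\<And>x y. f x \<bullet> y = - (x \<bullet> f y)"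
    and S: "subspace S" "f ` S \<subseteq> S"
  shows "\<exists>(b :: nat \<Rightarrow> 'a) c.
    (\<forall>i\<in>{1..dim S}. b i \<in> S) \<and>
    (\<forall>i\<in>{1..dim S}. \<forall>j\<in>{1..dim S}. b i \<bullet> b j = (if i = j then 1 else 0)) \<and>
    nonneg_decreasing_on {1..dim S div 2} c \<and>
    (\<forall>l\<in>{1..dim S div 2}. f (b (2 * l - 1)) = c l *\<^sub>R b (2 * l) \<and> f (b (2 * l)) = - c l *\<^sub>R b (2 * l - 1)) \<and>
    (odd (dim S) \<longrightarrow> f (b (dim S)) = 0)"
  using S
proof (induction "dim S" arbitrary: S rule: less_induct)
  case less
  interpret linear f by (rule lin)
  consider "dim S = 0" | "dim S = 1" | "dim S \<ge> 2"
    by linarith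
  then show ?case
  proof cases
    case 1
    then show ?thesis
      by (simp only:) (simp add: nonneg_decreasing_on_def monotone_on_def)
  next
    case 2
    then obtain z where z: "z \<in> S" "z \<noteq> 0"
      by (metis dim_eq_0 one_neq_zero singleton_iff subsetI)
    define u where "u = z /\<^sub>R norm z"
    have u: "u \<in> S" "u \<bullet> u = 1"
      using z less.prems by (auto simp: u_def subspace_scale dot_square_norm)
    have "span {u} = S"
      using u 2 less.prems by (intro dim_eq_span[of "{u}" S, unfolded span_eq_iff[THEN iffD2, OF less.prems(1)]])
        (auto simp: dim_insert)
    moreover have "f u \<in> S"
      using u less.prems by auto
    ultimately obtain s where s: "f u = s *\<^sub>R u"
      by (auto simp: span_singleton)
    then have "f u = 0"
      using skew_sym_square[OF skew, of u] u by simp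
    then show ?thesis
      using u 2 by (intro exI[of _ "\<lambda>_. u"] exI[of _ "\<lambda>_. 0"])
        (auto simp: nonneg_decreasing_on_def monotone_on_def)
  next
    case 3
    obtain t u v where t: "0 \<le> t" and uv: "u \<in> S" "v \<in> S" "norm u = 1" "norm v = 1" "u \<bullet> v = 0"
      and fuv: "f u = t *\<^sub>R v" "f v = - t *\<^sub>R u"
      and bound: "\<And>x. x \<in> S \<Longrightarrow> norm (f x) \<le> t * norm x"
      by (rule skew_maximal_plane[OF lin skew less.prems 3]) blast
    have uv1: "u \<bullet> u = 1" "v \<bullet> v = 1" "v \<bullet> u = 0"
      using uv by (simp_all add: norm_eq_1 inner_commute)
    define T where "T = {y \<in> S. \<forall>x\<in>span {u, v}. orthogonal x y}"
    have T_iff: "y \<in> T \<longleftrightarrow> y \<in> S \<and> u \<bullet> y = 0 \<and> v \<bullet> y = 0" for y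
    proof -
      have "(\<forall>x\<in>span {u, v}. orthogonal x y) \<longleftrightarrow> orthogonal u y \<and> orthogonal v y"
      proof safe
        fix x assume "orthogonal u y" "orthogonal v y" "x \<in> span {u, v}"
        then show "orthogonal x y"
          using orthogonal_to_span[of x "{u, v}" y] by (auto simp: orthogonal_commute)
      qed (auto simp: span_base)
      then show ?thesis
        by (simp add: T_def orthogonal_def)
    qed
    have "independent {u, v}"
      by (rule pairwise_orthogonal_independent) (use uv uv1 in \<open>auto simp: pairwise_def orthogonal_def\<close>)
    moreover have "u \<noteq> v"
      using uv1 uv by auto
    ultimately have "dim (span {u, v}) = 2"
      by (simp add: dim_eq_card_independent)
    moreover have "dim T + dim (span {u, v}) = dim S"
      unfolding T_def using uv less.prems
      by (intro dim_subspace_orthogonal_to_vectors) (auto simp: span_minimal)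
    ultimately have dT: "dim S = dim T + 2"
      by simp
    have "subspace T"
      using less.prems by (auto simp: subspace_def T_iff inner_add_right)
    moreover have "f ` T \<subseteq> T"
    proof clarsimp
      fix y assume y: "y \<in> T"
      have "u \<bullet> f y = 0" "v \<bullet> f y = 0"
        using skew[of u y] skew[of v y] fuv y by (simp_all add: T_iff)
      then show "f y \<in> T"
        using y less.prems by (auto simp: T_iff)
    qed
    ultimately obtain b c where b: "\<forall>i\<in>{1..dim T}. b i \<in> T"
        "\<forall>i\<in>{1..dim T}. \<forall>j\<in>{1..dim T}. b i \<bullet> b j = (if i = j then 1 else 0)"
      and c: "nonneg_decreasing_on {1..dim T div 2} c"
      and fb: "\<forall>l\<in>{1..dim T div 2}. f (b (2 * l - 1)) = c l *\<^sub>R b (2 * l) \<and> f (b (2 * l)) = - c l *\<^sub>R b (2 * l - 1)"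
        "odd (dim T) \<longrightarrow> f (b (dim T)) = 0"
      using less.hyps[of T] dT by auto
    define b' where "b' i = (if i = 1 then u else if i = 2 then v else b (i - 2))" for i
    define c' where "c' l = (if l = 1 then t else c (l - 1))" for l :: nat
    have b_orth: "u \<bullet> b i = 0" "v \<bullet> b i = 0" "b i \<bullet> u = 0" "b i \<bullet> v = 0" "b i \<in> S"
      if "i \<in> {1..dim T}" for i
      using b(1) that by (auto simp: T_iff inner_commute)
    have ct: "c l \<le> t" if l: "l \<in> {1..dim T div 2}" for l
    proof -
      have i: "2 * l - 1 \<in> {1..dim T}" "2 * l \<in> {1..dim T}"
        using l by auto
      then have "norm (b (2 * l - 1)) = 1" "norm (b (2 * l)) = 1"
        using b(2) by (auto simp: norm_eq_1)
      moreover have "norm (f (b (2 * l - 1))) \<le> t * norm (b (2 * l - 1))"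
        using bound b_orth i by blast
      ultimately show ?thesis
        using fb(1) l by auto
    qed
    show ?thesis
    proof (intro exI[of _ b'] exI[of _ c'] conjI ballI impI)
      fix i assume i: "i \<in> {1..dim S}"
      then have i': "i = 1 \<or> i = 2 \<or> i - 2 \<in> {1..dim T} \<and> i > 2"
        using dT by auto
      then show "b' i \<in> S"
        using uv b_orth by (auto simp: b'_def)
      fix j assume j: "j \<in> {1..dim S}"
      then have j': "j = 1 \<or> j = 2 \<or> j - 2 \<in> {1..dim T} \<and> j > 2"
        using dT by auto
      have "b (i - 2) \<bullet> b (j - 2) = (if i - 2 = j - 2 then 1 else 0)"
        if "i - 2 \<in> {1..dim T}" "j - 2 \<in> {1..dim T}"
        using that b by blast
      then show "b' i \<bullet> b' j = (if i = j then 1 else 0)"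
        using i' j' uv uv1 b_orth[of "i - 2"] b_orth[of "j - 2"]
        by (elim disjE conjE) (simp_all add: b'_def, linarith+)
    next
      show "nonneg_decreasing_on {1..dim S div 2} c'"
        unfolding nonneg_decreasing_on_def monotone_on_def
      proof (intro conjI ballI impI)
        fix i j assume ij: "i \<in> {1..dim S div 2}" "j \<in> {1..dim S div 2}" "i \<le> j"
        then have "j = 1 \<or> j - 1 \<in> {1..dim T div 2}" "i = 1 \<or> i - 1 \<in> {1..dim T div 2}" "i - 1 \<le> j - 1"
          using dT by auto
        then show "c' j \<le> c' i"
          using c ct ij(3) unfolding c'_def nonneg_decreasing_on_def monotone_on_def by auto
      next
        fix i assume i: "i \<in> {1..dim S div 2}"
        then have "i = 1 \<or> i - 1 \<in> {1..dim T div 2}"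
          using dT by auto
        then show "0 \<le> c' i"
          using c t unfolding c'_def nonneg_decreasing_on_def by auto
      qed
    next
      fix l assume l: "l \<in> {1..dim S div 2}"
      show "f (b' (2 * l - 1)) = c' l *\<^sub>R b' (2 * l)" "f (b' (2 * l)) = - c' l *\<^sub>R b' (2 * l - 1)"
      proof -
        consider "l = 1" | k where "l = Suc k" "k \<in> {1..dim T div 2}"
          using l dT by (cases l) force+
        then have "f (b' (2 * l - 1)) = c' l *\<^sub>R b' (2 * l) \<and> f (b' (2 * l)) = - c' l *\<^sub>R b' (2 * l - 1)"
        proof cases
          case 1
          then show ?thesis
            using fuv by (simp add: b'_def c'_def)
        next
          case (2 k)
          then have "2 * l - 1 - 2 = 2 * k - 1" "2 * l - 2 = 2 * k" "l - 1 = k" "2 * l - 1 > 2" "l > 1"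
            by auto
          then show ?thesis
            using fb(1) 2(2) by (simp add: b'_def c'_def)
        qed
        then show "f (b' (2 * l - 1)) = c' l *\<^sub>R b' (2 * l)" "f (b' (2 * l)) = - c' l *\<^sub>R b' (2 * l - 1)"
          by auto
      qed
    next
      assume "odd (dim S)"
      then have "odd (dim T)" "dim S \<noteq> 1" "dim S \<noteq> 2" "dim S - 2 = dim T"
        using dT by presburger+
      then show "f (b' (dim S)) = 0"
        using fb(2) by (simp add: b'_def)
    qed
  qed
qed

section \<open>Orbits of vector fields under isometries\<close>

text \<open>Euclidean isometries are the maps \<open>R x + p\<close> with \<open>R\<close> orthogonal, and the derivative of such a map is
  \<open>R\<close> at every point. In this form the push-forward involves neither derivatives nor inverses.\<close>

lemma mem_isometry_orbit_iff:
  fixes V W :: "real^'n \<Rightarrow> real^'n"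
  shows "V \<in> isometry_orbit W \<longleftrightarrow>
    (\<exists>R p. orthogonal_transformation R \<and> (\<forall>x. V (R x + p) = R (W x)))"
proof
  assume "V \<in> isometry_orbit W"
  then obtain \<phi> :: "real^'n \<Rightarrow> real^'n" where \<phi>: "bij \<phi>" "\<And>x y. dist (\<phi> x) (\<phi> y) = dist x y"
    and V: "V = push_forward \<phi> W"
    by (auto simp: isometry_orbit_def isometry_group_def)
  define R where "R x = \<phi> x - \<phi> 0" for x
  have R: "orthogonal_transformation R"
    unfolding orthogonal_transformation_isometry using \<phi>(2) by (simp add: R_def dist_norm)
  obtain p where p: "\<phi> = (\<lambda>x. R x + p)"
    by (rule that[of "\<phi> 0"]) (simp add: R_def)
  have "(\<phi> has_derivative R) (at x)" for x
    using has_derivative_add_const[OF linear_imp_has_derivative[OF orthogonal_transformation_linear[OF R]]]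
    unfolding p .
  then have "frechet_derivative \<phi> (at x) = R" for x
    by (metis frechet_derivative_at)
  moreover have "inv \<phi> (R x + p) = x" for x
    using inv_f_f[OF bij_is_inj[OF \<phi>(1)], of x] by (simp add: p)
  ultimately have "V (R x + p) = R (W x)" for x
    by (simp add: V push_forward_def)
  with R show "\<exists>R p. orthogonal_transformation R \<and> (\<forall>x. V (R x + p) = R (W x))"
    by blast
next
  assume "\<exists>R p. orthogonal_transformation R \<and> (\<forall>x. V (R x + p) = R (W x))"
  then obtain R p where R: "orthogonal_transformation R" and V: "\<And>x. V (R x + p) = R (W x)"
    by blast
  define \<phi> where "\<phi> x = R x + p" for x
  have "bij R"
    using R by (rule orthogonal_transformation_bij)
  have bij: "bij \<phi>"
    using bij_betw_comp_iff[OF \<open>bij R\<close>, of "\<lambda>x. x + p" UNIV] bij_plus_right[of p]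
    by (simp add: \<phi>_def[abs_def] comp_def)
  have "dist (\<phi> x) (\<phi> y) = dist x y" for x y
    using R by (simp add: \<phi>_def dist_norm orthogonal_transformation_isometry)
  moreover have "push_forward \<phi> W = V"
  proof
    fix y
    obtain x where y: "y = \<phi> x"
      using bij by (metis bij_pointE)
    have "(\<phi> has_derivative R) (at x)"
      using has_derivative_add_const[OF linear_imp_has_derivative[OF orthogonal_transformation_linear[OF R]]]
      unfolding \<phi>_def[abs_def] .
    then have "frechet_derivative \<phi> (at x) = R"
      by (metis frechet_derivative_at)
    moreover have "inv \<phi> y = x"
      using bij y by (simp add: bij_is_inj)
    ultimately show "push_forward \<phi> W y = V y"
      using V[of x] y by (simp add: push_forward_def \<phi>_def)
  qed
  ultimately show "V \<in> isometry_orbit W"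
    using bij unfolding isometry_orbit_def isometry_group_def by blast
qed

lemma isometry_orbit_refl: "W \<in> isometry_orbit W"
  unfolding mem_isometry_orbit_iff
  by (intro exI[of _ "\<lambda>x. x"] exI[of _ 0]) (simp add: orthogonal_transformation_def linear_id)

lemma isometry_orbit_sym:
  assumes "V \<in> isometry_orbit W" shows "W \<in> isometry_orbit V"
proof -
  obtain R p where R: "orthogonal_transformation R" and V: "\<And>x. V (R x + p) = R (W x)"
    using assms unfolding mem_isometry_orbit_iff by blast
  have I: "orthogonal_transformation (inv R)" and b: "bij R"
    using R by (auto intro: orthogonal_transformation_inv orthogonal_transformation_bij)
  have "W (inv R x + - inv R p) = inv R (V x)" for x
    using V[of "inv R x + - inv R p"] R b
    by (simp add: orthogonal_transformation_linear linear_diff bij_is_inj bij_is_surj surj_f_inv_f)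
  with I show ?thesis
    unfolding mem_isometry_orbit_iff by blast
qed

lemma isometry_orbit_trans:
  assumes "U \<in> isometry_orbit V" "V \<in> isometry_orbit W" shows "U \<in> isometry_orbit W"
proof -
  obtain R p where R: "orthogonal_transformation R" and U: "\<And>x. U (R x + p) = R (V x)"
    using assms(1) unfolding mem_isometry_orbit_iff by blast
  obtain S q where S: "orthogonal_transformation S" and V: "\<And>x. V (S x + q) = S (W x)"
    using assms(2) unfolding mem_isometry_orbit_iff by blast
  have "U ((R \<circ> S) x + (R q + p)) = (R \<circ> S) (W x)" for x
    using U[of "S x + q"] V[of x] R
    by (simp add: orthogonal_transformation_linear linear_add add.assoc)
  then show ?thesis
    using orthogonal_transformation_compose[OF R S] unfolding mem_isometry_orbit_iff by blast
qed

lemma isometry_orbit_eq_iff: "isometry_orbit V = isometry_orbit W \<longleftrightarrow> V \<in> isometry_orbit W"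
  using isometry_orbit_refl isometry_orbit_sym isometry_orbit_trans by blast

lemma isometry_orbit_norm_range:
  assumes "V \<in> isometry_orbit W"
  shows "\<exists>y. norm (V y) = norm (W x)"
proof -
  obtain R p where "orthogonal_transformation R" "V (R x + p) = R (W x)"
    using assms unfolding mem_isometry_orbit_iff by blast
  then show ?thesis
    by (metis orthogonal_transformation_norm)
qed

lemma isometry_orbit_bounded_iff:
  "(\<forall>V\<in>isometry_orbit W. \<forall>x. norm (V x) < 1) \<longleftrightarrow> (\<forall>x. norm (W x) < 1)"
  by (metis isometry_orbit_norm_range isometry_orbit_refl isometry_orbit_sym)

section \<open>The normal forms\<close>

text \<open>The common generalization of \<open>linear_form\<close> and \<open>affine_form\<close>, with the number \<open>k\<close> of blocks and the
  translation component \<open>s\<close> along the last axis as separate arguments. Invariants of orbits are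
  computed for this family once, and the two kinds of normal form can be compared with each other.\<close>

definition block_field ::
    "('n::finite \<Rightarrow> nat) \<Rightarrow> nat \<Rightarrow> (nat \<Rightarrow> real) \<Rightarrow> real \<Rightarrow> real^'n \<Rightarrow> real^'n" where
  "block_field e k c s = (\<lambda>x. (- J_sum e k c) *v x + (\<chi> i. if e i = CARD('n) then s else 0))"

lemma linear_form_eq_block_field: "linear_form e m a = block_field e m a 0"
  by (simp add: linear_form_def block_field_def vec_eq_iff fun_eq_iff)

lemma affine_form_eq_block_field: "affine_form e m a = block_field e (m - 1) (\<lambda>l. a (l + 1)) (a 1)"
  unfolding affine_form_def block_field_def ..

lemma block_field_cong:
  assumes "\<And>l. l \<in> {1..k} \<Longrightarrow> c l = c' l"
  shows "block_field e k c s = block_field e k c' s"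
  using assms by (simp add: block_field_def J_sum_def)

lemma uminus_matrix_vector_mult: "(- A) *v x = - (A *v x)" for A :: "real^'n^'m"
  by (simp add: matrix_vector_mult_def vec_eq_iff sum_negf)

lemma transpose_uminus: "transpose (- A) = - transpose A" for A :: "real^'n^'m"
  by (simp add: transpose_def vec_eq_iff)

lemma skew_matrix_inner:
  fixes Q :: "real^'n^'n"
  assumes "transpose Q = - Q"
  shows "(Q *v x) \<bullet> y = - (x \<bullet> (Q *v y))"
proof -
  have "(Q *v x) \<bullet> y = y \<bullet> (Q *v x)"
    by (rule inner_commute)
  also have "\<dots> = (transpose Q *v y) \<bullet> x"
    by (simp add: dot_lmul_matrix)
  finally show ?thesis
    unfolding assms by (simp add: uminus_matrix_vector_mult inner_commute)
qed

lemma transpose_J_sum: "transpose (J_sum e k c) = - J_sum e k c"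
proof -
  have "transpose (J_sum e k c) $ i $ j = (- J_sum e k c) $ i $ j" for i j
    unfolding J_sum_def transpose_def vec_lambda_beta vector_uminus_component sum_negf[symmetric]
  proof (intro sum.cong refl)
    fix l assume "l \<in> {1..k}"
    then have "2 * l - 1 \<noteq> 2 * l"
      by auto
    then show "c l * (if e j = 2 * l - 1 \<and> e i = 2 * l then 1
        else if e j = 2 * l \<and> e i = 2 * l - 1 then - 1 else 0) =
      - (c l * (if e i = 2 * l - 1 \<and> e j = 2 * l then 1
        else if e i = 2 * l \<and> e j = 2 * l - 1 then - 1 else 0))"
      by (simp only: if_distrib) (simp split: if_split)
  qed
  then show ?thesis
    by (simp add: vec_eq_iff)
qed

context
  fixes e :: "'n::finite \<Rightarrow> nat"
  assumes e: "bij_betw e UNIV {1..CARD('n)}"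
begin

lemma e_eq_iff: "e i = e j \<longleftrightarrow> i = j"
  using e by (auto simp: bij_betw_def inj_on_def)

lemma e_range: "1 \<le> e i" "e i \<le> CARD('n)"
  using bij_betwE[OF e] by auto

lemma e_surj:
  assumes "1 \<le> p" "p \<le> CARD('n)"
  obtains i where "e i = p"
proof -
  have "p \<in> e ` UNIV"
    using assms bij_betw_imp_surj_on[OF e] by simp
  then show ?thesis
    using that by auto
qed

text \<open>The coordinates split into the first and second members \<open>i\<close>, \<open>j\<close> of the blocks and the coordinates
  on which the linear part of the field vanishes; matrix products are computed along this split.\<close>

lemma index_cases:
  assumes "2 * k \<le> CARD('n)"
  obtains (first) l j where "l \<in> {1..k}" "e i = 2 * l - 1" "e j = 2 * l"
    | (second) l j where "l \<in> {1..k}" "e j = 2 * l - 1" "e i = 2 * l"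
    | (rest) "e i > 2 * k"
proof -
  define l where "l = (e i + 1) div 2"
  show ?thesis
  proof (cases "e i > 2 * k")
    case False
    then have l: "l \<in> {1..k}"
      using e_range(1)[of i] by (auto simp: l_def)
    show ?thesis
    proof (cases "odd (e i)")
      case True
      then have "e i = 2 * l - 1"
        by (auto simp: l_def elim: oddE)
      moreover obtain j where "e j = 2 * l"
        by (rule e_surj[of "2 * l"]) (use l assms in auto)
      ultimately show ?thesis
        using l first by blast
    next
      case False
      then have "e i = 2 * l"
        by (auto simp: l_def elim: evenE)
      moreover obtain j where "e j = 2 * l - 1"
        by (rule e_surj[of "2 * l - 1"]) (use l assms in auto)
      ultimately show ?thesis
        using l second by blast
    qed
  qed (rule rest)
qed

lemma J_sum_mult_first:
  assumes l: "l \<in> {1..k}" and ij: "e i = 2 * l - 1" "e j = 2 * l"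
  shows "(J_sum e k c *v x) $ i = c l * x $ j"
proof -
  have "J_sum e k c $ i $ j' = (if j' = j then c l else 0)" for j'
  proof -
    have "J_sum e k c $ i $ j' = (\<Sum>l'=1..k. if l' = l then if j' = j then c l else 0 else 0)"
      unfolding J_sum_def vec_lambda_beta
    proof (intro sum.cong refl)
      fix l' assume "l' \<in> {1..k}"
      moreover have "e i \<noteq> 2 * l'"
        using ij(1) l by simp presburger
      moreover have "e i = 2 * l' - 1 \<longleftrightarrow> l' = l"
        using ij(1) l \<open>l' \<in> {1..k}\<close> by auto
      moreover have "e j' = 2 * l \<longleftrightarrow> j' = j"
        using ij(2) e_eq_iff by metis
      ultimately show "c l' * (if e i = 2 * l' - 1 \<and> e j' = 2 * l' then 1
          else if e i = 2 * l' \<and> e j' = 2 * l' - 1 then - 1 else 0) =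
        (if l' = l then if j' = j then c l else 0 else 0)"
        by simp
    qed
    then show ?thesis
      using l by (simp add: sum.delta)
  qed
  then show ?thesis
    by (simp add: matrix_vector_mult_def if_distrib[of "\<lambda>a. a * _"] sum.delta cong: if_cong)
qed

lemma J_sum_mult_second:
  assumes l: "l \<in> {1..k}" and ij: "e i = 2 * l - 1" "e j = 2 * l"
  shows "(J_sum e k c *v x) $ j = - c l * x $ i"
proof -
  have "J_sum e k c $ j $ i' = (if i' = i then - c l else 0)" for i'
  proof -
    have "J_sum e k c $ j $ i' = (\<Sum>l'=1..k. if l' = l then if i' = i then - c l else 0 else 0)"
      unfolding J_sum_def vec_lambda_beta
    proof (intro sum.cong refl)
      fix l' assume "l' \<in> {1..k}"
      then have "e j \<noteq> 2 * l' - 1"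
        using ij(2) by simp presburger
      moreover have "e j = 2 * l' \<longleftrightarrow> l' = l"
        using ij(2) by auto
      moreover have "e i' = 2 * l - 1 \<longleftrightarrow> i' = i"
        using ij(1) e_eq_iff by metis
      ultimately show "c l' * (if e j = 2 * l' - 1 \<and> e i' = 2 * l' then 1
          else if e j = 2 * l' \<and> e i' = 2 * l' - 1 then - 1 else 0) =
        (if l' = l then if i' = i then - c l else 0 else 0)"
        by simp
    qed
    then show ?thesis
      using l by (simp add: sum.delta)
  qed
  then show ?thesis
    by (simp add: matrix_vector_mult_def if_distrib[of "\<lambda>a. a * _"] sum.delta cong: if_cong)
qed

lemma J_sum_mult_rest:
  assumes "e i > 2 * k"
  shows "(J_sum e k c *v x) $ i = 0"
proof -
  have "J_sum e k c $ i $ j = 0" for j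
    unfolding J_sum_def vec_lambda_beta
  proof (rule sum.neutral, intro ballI)
    fix l assume "l \<in> {1..k}"
    then have "e i \<noteq> 2 * l" "e i \<noteq> 2 * l - 1"
      using assms by auto
    then show "c l * (if e i = 2 * l - 1 \<and> e j = 2 * l then 1
        else if e i = 2 * l \<and> e j = 2 * l - 1 then - 1 else 0) = 0"
      by simp
  qed
  then show ?thesis
    by (simp add: matrix_vector_mult_def)
qed

lemma block_field_zero:
  assumes "e i = CARD('n)"
  shows "block_field e k c s 0 = s *\<^sub>R axis i 1"
proof -
  have "e j = CARD('n) \<longleftrightarrow> j = i" for j
    using assms e_eq_iff by metis
  then show ?thesis
    by (simp add: block_field_def vec_eq_iff axis_def)
qed

lemma norm_block_field_zero: "norm (block_field e k c s 0) = \<bar>s\<bar>"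
proof -
  obtain i where "e i = CARD('n)"
    by (rule e_surj[of "CARD('n)"]) (auto simp: Suc_le_eq)
  then show ?thesis
    by (simp add: block_field_zero)
qed

text \<open>If \<open>2 * k < n\<close>, the last coordinate lies outside the blocks, so there the field is constantly \<open>s\<close>. As
  the bound is attained at the origin, \<open>\<bar>s\<bar>\<close> is the minimal length of the field.\<close>

lemma norm_block_field_ge:
  assumes "s = 0 \<or> 2 * k < CARD('n)"
  shows "\<bar>s\<bar> \<le> norm (block_field e k c s x)"
proof (cases "s = 0")
  case False
  obtain i where i: "e i = CARD('n)"
    by (rule e_surj[of "CARD('n)"]) (auto simp: Suc_le_eq)
  then have "block_field e k c s x $ i = s"
    using assms False by (simp add: block_field_def uminus_matrix_vector_mult J_sum_mult_rest)
  then show ?thesis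
    by (metis component_le_norm_cart)
qed simp

lemma block_field_admissible:
  assumes "\<bar>s\<bar> < 1"
  shows "block_field e k c s \<in> admissible_fields"
proof -
  have "transpose (- J_sum e k c) = - (- J_sum e k c)"
    by (simp add: transpose_uminus transpose_J_sum)
  then have "block_field e k c s \<in> killing_fields"
    unfolding killing_fields_def block_field_def by blast
  moreover have "open {x. norm (block_field e k c s x) < 1}"
    unfolding block_field_def
    by (intro open_Collect_less continuous_intros matrix_vector_mult_linear_continuous_on)
  moreover have "0 \<in> {x. norm (block_field e k c s x) < 1}"
    using assms by (simp add: norm_block_field_zero)
  ultimately show ?thesis
    unfolding admissible_fields_def by blast
qed

lemma block_field_bounded_iff:
  assumes k: "2 * k \<le> CARD('n)" and s: "\<bar>s\<bar> < 1"
  shows "(\<forall>x. norm (block_field e k c s x) < 1) \<longleftrightarrow> (\<forall>l\<in>{1..k}. c l = 0)"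
proof
  assume bounded: "\<forall>x. norm (block_field e k c s x) < 1"
  show "\<forall>l\<in>{1..k}. c l = 0"
  proof (rule ballI, rule ccontr)
    fix l assume l: "l \<in> {1..k}" "c l \<noteq> 0"
    obtain i where i: "e i = 2 * l - 1"
      by (rule e_surj[of "2 * l - 1"]) (use l k in auto)
    obtain j where j: "e j = 2 * l"
      by (rule e_surj[of "2 * l"]) (use l k in auto)
    define r where "r = (2 - (if e j = CARD('n) then s else 0)) / c l"
    have "block_field e k c s (axis i r) $ j = 2"
      using J_sum_mult_second[OF l(1) i j, of c "axis i r"] l
      by (simp add: block_field_def uminus_matrix_vector_mult axis_def r_def)
    then have "2 \<le> norm (block_field e k c s (axis i r))"
      by (metis abs_numeral component_le_norm_cart)
    then show False
      using bounded[rule_format, of "axis i r"] by linarith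
  qed
next
  assume c: "\<forall>l\<in>{1..k}. c l = 0"
  show "\<forall>x. norm (block_field e k c s x) < 1"
  proof
    fix x
    have "J_sum e k c = 0"
      using c by (simp add: J_sum_def vec_eq_iff)
    then have "block_field e k c s x = block_field e k c s 0"
      by (simp add: block_field_def)
    then show "norm (block_field e k c s x) < 1"
      using s by (simp add: norm_block_field_zero)
  qed
qed

section \<open>Distinct parameters give distinct orbits\<close>

lemma block_field_orbit_constant_le:
  assumes "block_field e k' c' s' \<in> isometry_orbit (block_field e k c s)"
    and "s' = 0 \<or> 2 * k' < CARD('n)"
  shows "\<bar>s'\<bar> \<le> \<bar>s\<bar>"
proof -
  obtain y where "norm (block_field e k' c' s' y) = norm (block_field e k c s 0)"
    using isometry_orbit_norm_range[OF assms(1)] by blast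
  then show ?thesis
    using norm_block_field_ge[OF assms(2)] by (metis norm_block_field_zero)
qed

text \<open>Fields in one orbit take the same lengths, in particular the same minimal length.\<close>

lemma block_field_orbit_constant_unique:
  assumes "block_field e k' c' s' \<in> isometry_orbit (block_field e k c s)"
    and "s = 0 \<or> 2 * k < CARD('n)" "s' = 0 \<or> 2 * k' < CARD('n)" "0 \<le> s" "0 \<le> s'"
  shows "s = s'"
  using block_field_orbit_constant_le[OF assms(1,3)]
    block_field_orbit_constant_le[OF isometry_orbit_sym[OF assms(1)] assms(2)] assms(4,5)
  by simp

text \<open>The square of a block matrix is diagonal, with entry \<open>- (c l)\<^sup>2\<close> at both coordinates of the \<open>l\<close>-th
  block and zero elsewhere. So the eigenspace is a coordinate subspace, and its dimension counts
  coordinates. The sign condition on \<open>c\<close> lets \<open>t\<close> be recovered from \<open>t\<^sup>2\<close>.\<close>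

lemma J_sum_eigenspace_dim:
  assumes k: "2 * k \<le> CARD('n)" and c: "\<And>l. l \<in> {1..k} \<Longrightarrow> 0 \<le> c l" and t: "0 \<le> t"
  shows "dim {x. J_sum e k c *v (J_sum e k c *v x) = - t\<^sup>2 *\<^sub>R x} =
    2 * card {l \<in> {1..k}. c l = t} + (if t = 0 then CARD('n) - 2 * k else 0)"
proof -
  let ?J = "\<lambda>x. J_sum e k c *v x"
  define P where "P p \<longleftrightarrow> (if p \<le> 2 * k then c ((p + 1) div 2) = t else t = 0)" for p
  let ?D = "{i. P (e i)}"
  have component: "(?J (?J x)) $ i = - t\<^sup>2 * x $ i \<longleftrightarrow> (P (e i) \<or> x $ i = 0)" for x i
  proof -
    have sq: "c l * (c l * y) = t\<^sup>2 * y \<longleftrightarrow> c l = t \<or> y = 0" if "l \<in> {1..k}" for l y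
    proof -
      have "c l * (c l * y) = (c l)\<^sup>2 * y"
        by (simp add: power2_eq_square)
      then show ?thesis
        using power2_eq_iff_nonneg[OF c[OF that] t] by auto
    qed
    show ?thesis
    proof (cases i rule: index_cases[OF k, case_names first second rest])
      case (first l j)
      then have "P (e i) \<longleftrightarrow> c l = t"
        by (auto simp: P_def)
      then show ?thesis
        using sq[of l "x $ i"] first by (simp add: J_sum_mult_first[OF first] J_sum_mult_second[OF first])
    next
      case (second l j)
      then have "P (e i) \<longleftrightarrow> c l = t"
        by (auto simp: P_def)
      then show ?thesis
        using sq[of l "x $ i"] second by (simp add: J_sum_mult_first[OF second] J_sum_mult_second[OF second])
    next
      case rest
      then show ?thesis
        by (auto simp: P_def J_sum_mult_rest)
    qed
  qed
  have "{x. ?J (?J x) = - t\<^sup>2 *\<^sub>R x} = {x. \<forall>i. P (e i) \<or> x $ i = 0}"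
    using component by (simp add: vec_eq_iff)
  also have "\<dots> = {x. \<forall>b\<in>Basis. b \<notin> (\<lambda>i. axis i 1) ` ?D \<longrightarrow> x \<bullet> b = 0}"
    by (auto simp: Basis_vec_def inner_axis axis_eq_axis image_iff)
  also have "dim \<dots> = card ((\<lambda>i. axis i (1::real)) ` ?D)"
    by (intro dim_substandard) (auto simp: axis_in_Basis_iff)
  also have "\<dots> = card ?D"
    by (intro card_image) (auto simp: inj_on_def axis_eq_axis)
  also have "\<dots> = card (e ` ?D)"
    by (intro card_image[symmetric]) (auto simp: inj_on_def e_eq_iff)
  also have "e ` ?D = {p \<in> {1..CARD('n)}. P p}"
    using bij_betw_imp_surj_on[OF e] by auto
  also have "\<dots> = ((\<lambda>l. 2 * l - 1) ` {l \<in> {1..k}. c l = t} \<union> (\<lambda>l. 2 * l) ` {l \<in> {1..k}. c l = t})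
      \<union> (if t = 0 then {2 * k + 1..CARD('n)} else {})" (is "?L = (?A \<union> ?B) \<union> ?C")
  proof (intro equalityI subsetI)
    fix p assume p: "p \<in> ?L"
    show "p \<in> ?A \<union> ?B \<union> ?C"
    proof (cases "p \<le> 2 * k")
      case True
      define l where "l = (p + 1) div 2"
      have "l \<in> {1..k}" "c l = t" "p = 2 * l - 1 \<or> p = 2 * l"
        using p True by (auto simp: l_def P_def)
      then show ?thesis
        by auto
    qed (use p in \<open>auto simp: P_def\<close>)
  next
    fix p assume "p \<in> ?A \<union> ?B \<union> ?C"
    then show "p \<in> ?L"
      using k by (auto simp: P_def split: if_splits)
  qed
  also have "card \<dots> = card ?A + card ?B + card ?C"
  proof -
    have "?A \<inter> ?B = {}"
      by auto presburger
    moreover have "(?A \<union> ?B) \<inter> ?C = {}"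
      by (auto split: if_splits)
    ultimately show ?thesis
      by (simp add: card_Un_disjoint)
  qed
  also have "card ?A = card {l \<in> {1..k}. c l = t}"
    by (intro card_image) (auto simp: inj_on_def)
  also have "card ?B = card {l \<in> {1..k}. c l = t}"
    by (intro card_image) (auto simp: inj_on_def)
  finally show ?thesis
    by simp
qed

text \<open>The orthogonal part of the isometry conjugates the linear parts, hence embeds the first eigenspace
  into the second. Equality follows by symmetry of the orbit relation.\<close>

lemma block_field_orbit_eigenspace_dim:
  assumes "block_field e k c' s' \<in> isometry_orbit (block_field e k c s)"
  shows "dim {x. J_sum e k c *v (J_sum e k c *v x) = r *\<^sub>R x} \<le>
    dim {x. J_sum e k c' *v (J_sum e k c' *v x) = r *\<^sub>R x}" (is "dim ?E \<le> dim ?E'")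
proof -
  obtain R p where R: "orthogonal_transformation R"
    and eq: "\<And>x. block_field e k c' s' (R x + p) = R (block_field e k c s x)"
    using assms unfolding mem_isometry_orbit_iff by blast
  interpret R: linear R
    using R by (rule orthogonal_transformation_linear)
  have intertwine: "J_sum e k c' *v R x = R (J_sum e k c *v x)" for x
    using eq[of x] eq[of 0]
    by (simp add: block_field_def R.add R.neg R.diff R.zero uminus_matrix_vector_mult
        matrix_vector_right_distrib algebra_simps)
  have "R ` ?E \<subseteq> ?E'"
    by (auto simp: intertwine R.scale)
  moreover have "dim (R ` ?E) = dim ?E"
    by (rule eucl.dim_image_eq[OF R.linear_axioms
          inj_on_subset[OF orthogonal_transformation_inj[OF R] subset_UNIV]])
  ultimately show ?thesis
    using dim_subset[of "R ` ?E" ?E'] by simp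
qed

end

text \<open>At the first index \<open>l\<close> where the sequences differ, let \<open>t\<close> be the larger value. The sequence with the
  smaller value stays below \<open>t\<close> from \<open>l\<close> on, so its \<open>t\<close>-level set consists of common earlier indices
  and misses \<open>l\<close>, which belongs to the other level set.\<close>

lemma decreasing_eq_if_level_cards_eq:
  fixes c c' :: "nat \<Rightarrow> real"
  assumes dec: "antimono_on {1..k} c" "antimono_on {1..k} c'"
    and card: "\<And>l. l \<in> {1..k} \<Longrightarrow> card {i \<in> {1..k}. c i = c l} = card {i \<in> {1..k}. c' i = c l}"
      "\<And>l. l \<in> {1..k} \<Longrightarrow> card {i \<in> {1..k}. c i = c' l} = card {i \<in> {1..k}. c' i = c' l}"
    and l: "l \<in> {1..k}"
  shows "c l = c' l"
  using l
proof (induction l rule: less_induct)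
  case (less l)
  have *: False
    if dec: "antimono_on {1..k} f"
      and card: "card {i \<in> {1..k}. f i = g l} = card {i \<in> {1..k}. g i = g l}"
      and eq: "\<And>i. i \<in> {1..k} \<Longrightarrow> i < l \<Longrightarrow> f i = g i"
      and lt: "f l < g l" for f g :: "nat \<Rightarrow> real"
  proof -
    have below: "i < l" if "i \<in> {1..k}" "f i = g l" for i
    proof (rule ccontr)
      assume "\<not> i < l"
      then have "f i \<le> f l"
        by (intro monotone_onD[OF dec less.prems that(1)]) simp
      then show False
        using lt that(2) by simp
    qed
    have "{i \<in> {1..k}. f i = g l} \<subseteq> {i \<in> {1..k}. g i = g l}"
    proof
      fix i assume i: "i \<in> {i \<in> {1..k}. f i = g l}"
      then have "f i = g i"
        using below[of i] by (intro eq) simp_all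
      with i show "i \<in> {i \<in> {1..k}. g i = g l}"
        by simp
    qed
    moreover have "l \<notin> {i \<in> {1..k}. f i = g l}" "l \<in> {i \<in> {1..k}. g i = g l}"
      using lt less.prems by auto
    ultimately have "{i \<in> {1..k}. f i = g l} \<subset> {i \<in> {1..k}. g i = g l}"
      by blast
    then have "card {i \<in> {1..k}. f i = g l} < card {i \<in> {1..k}. g i = g l}"
      by (intro psubset_card_mono) simp_all
    then show False
      using card by simp
  qed
  have IH: "c i = c' i" if "i \<in> {1..k}" "i < l" for i
    using less.IH that by blast
  have "\<not> c l < c' l"
    using *[of c c', OF dec(1) card(2)[OF less.prems] IH] by (rule notI)
  moreover have "\<not> c' l < c l"
    using *[of c' c, OF dec(2) card(1)[OF less.prems, symmetric] IH[symmetric]] by (rule notI)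
  ultimately show ?case
    by simp
qed

context
  fixes e :: "'n::finite \<Rightarrow> nat"
  assumes e: "bij_betw e UNIV {1..CARD('n)}"
begin

lemma block_field_orbit_coeffs_unique:
  assumes k: "2 * k \<le> CARD('n)"
    and c: "nonneg_decreasing_on {1..k} c" and c': "nonneg_decreasing_on {1..k} c'"
    and orbit: "block_field e k c' s' \<in> isometry_orbit (block_field e k c s)"
    and l: "l \<in> {1..k}"
  shows "c l = c' l"
proof (rule decreasing_eq_if_level_cards_eq[OF _ _ _ _ l])
  have level: "card {i \<in> {1..k}. c i = t} = card {i \<in> {1..k}. c' i = t}" if "0 \<le> t" for t
  proof -
    have "dim {x. J_sum e k c *v (J_sum e k c *v x) = - t\<^sup>2 *\<^sub>R x} =
        dim {x. J_sum e k c' *v (J_sum e k c' *v x) = - t\<^sup>2 *\<^sub>R x}"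
      using block_field_orbit_eigenspace_dim[OF e orbit]
        block_field_orbit_eigenspace_dim[OF e isometry_orbit_sym[OF orbit]]
      by (rule order_antisym)
    moreover note J_sum_eigenspace_dim[OF e k _ that, of c] J_sum_eigenspace_dim[OF e k _ that, of c']
    ultimately show ?thesis
      using c c' by (simp add: nonneg_decreasing_on_def)
  qed
  show "card {i \<in> {1..k}. c i = c l} = card {i \<in> {1..k}. c' i = c l}" if "l \<in> {1..k}" for l
    using c that by (intro level) (simp add: nonneg_decreasing_on_def)
  show "card {i \<in> {1..k}. c i = c' l} = card {i \<in> {1..k}. c' i = c' l}" if "l \<in> {1..k}" for l
    using c' that by (intro level) (simp add: nonneg_decreasing_on_def)
qed (use c c' in \<open>simp_all add: nonneg_decreasing_on_def\<close>)

section \<open>Every admissible field has a normal form\<close>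

text \<open>The orthogonal map sending the coordinate axes to the basis \<open>b\<close>, followed by translation by \<open>- v\<close>,
  carries the normal form to the given field.\<close>

lemma normal_basis_in_orbit:
  fixes Q :: "real^'n^'n" and b :: "nat \<Rightarrow> real^'n"
  assumes k: "2 * k \<le> CARD('n)" and Q: "transpose Q = - Q"
    and orth: "\<And>p q. p \<in> {1..CARD('n)} \<Longrightarrow> q \<in> {1..CARD('n)} \<Longrightarrow> b p \<bullet> b q = (if p = q then 1 else 0)"
    and pairs: "\<And>l. l \<in> {1..k} \<Longrightarrow> Q *v b (2 * l - 1) = c l *\<^sub>R b (2 * l)"
      "\<And>l. l \<in> {1..k} \<Longrightarrow> Q *v b (2 * l) = - c l *\<^sub>R b (2 * l - 1)"
    and rest: "\<And>p. p \<in> {2 * k + 1..CARD('n)} \<Longrightarrow> Q *v b p = 0"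
  shows "(\<lambda>x. Q *v (x + v) + s *\<^sub>R b CARD('n)) \<in> isometry_orbit (block_field e k c s)"
proof -
  define R :: "real^'n \<Rightarrow> real^'n" where "R x = (\<Sum>i\<in>UNIV. x $ i *\<^sub>R b (e i))" for x
  have e_mem: "e i \<in> {1..CARD('n)}" for i
    using e_range[OF e, of i] by simp
  have bb: "b (e i) \<bullet> b (e j) = (if i = j then 1 else 0)" for i j
    using orth[OF e_mem e_mem, of i j] e_eq_iff[OF e, of i j] by simp
  have coord: "b (e i) \<bullet> R x = x $ i" for i x
    by (simp add: R_def inner_sum_right bb if_distrib cong: if_cong)
  have lin: "linear R"
    by (rule linearI) (simp_all add: R_def scaleR_add_left sum.distrib scaleR_sum_right)
  interpret R: linear R
    by (rule lin)
  have "R x \<bullet> R y = x \<bullet> y" for x y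
  proof -
    have "R x \<bullet> R y = (\<Sum>i\<in>UNIV. x $ i * (b (e i) \<bullet> R y))"
      by (simp add: R_def[of x] inner_sum_left)
    also have "\<dots> = x \<bullet> y"
      unfolding coord by (simp add: inner_vec_def)
    finally show ?thesis .
  qed
  then have R: "orthogonal_transformation R"
    using lin by (simp add: orthogonal_transformation_def)
  have intertwine: "Q *v R x = R (- (J_sum e k c *v x))" for x
  proof -
    obtain z where z: "Q *v R x - R (- (J_sum e k c *v x)) = R z"
      using orthogonal_transformation_surj[OF R] by (metis surj_def)
    have "b (e i) \<bullet> (Q *v R x) = - (J_sum e k c *v x) $ i" for i
    proof -
      have "b (e i) \<bullet> (Q *v R x) = - ((Q *v b (e i)) \<bullet> R x)"
        using skew_matrix_inner[OF Q, of "b (e i)" "R x"] by simp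
      also have "\<dots> = - (J_sum e k c *v x) $ i"
      proof (cases i rule: index_cases[OF e k, case_names first second rest])
        case (first l j)
        then have "Q *v b (e i) = c l *\<^sub>R b (e j)"
          using pairs(1)[of l] by simp
        then show ?thesis
          by (simp add: coord J_sum_mult_first[OF e first])
      next
        case (second l j)
        then have "Q *v b (e i) = - c l *\<^sub>R b (e j)"
          using pairs(2)[of l] by simp
        then show ?thesis
          by (simp add: coord J_sum_mult_second[OF e second])
      next
        case rest': rest
        then have "Q *v b (e i) = 0"
          using e_mem[of i] by (intro rest) simp
        then show ?thesis
          using J_sum_mult_rest[OF e rest'] by simp
      qed
      finally show ?thesis .
    qed
    then have "z $ i = 0" for i
      unfolding coord[of i z, symmetric] z[symmetric] by (simp add: inner_diff_right coord)
    then have "z = 0"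
      by (simp add: vec_eq_iff)
    then show ?thesis
      using z by (simp add: R.zero)
  qed
  have translation: "R (\<chi> i. if e i = CARD('n) then s else 0) = s *\<^sub>R b CARD('n)"
  proof -
    obtain j where j: "e j = CARD('n)"
      by (rule e_surj[OF e, of "CARD('n)"]) (auto simp: Suc_le_eq)
    then have "(\<chi> i. if e i = CARD('n) then s else 0) = s *\<^sub>R axis j 1"
      using e_eq_iff[OF e, of _ j] by (simp add: vec_eq_iff axis_def)
    moreover have "R (axis j 1) = b (e j)"
      by (simp add: R_def axis_def if_distrib[of "\<lambda>a. a *\<^sub>R _"] cong: if_cong)
    ultimately show ?thesis
      using j by (simp add: R.scale)
  qed
  have "Q *v ((R x + - v) + v) + s *\<^sub>R b CARD('n) = R (block_field e k c s x)" for x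
    by (simp add: block_field_def R.add R.diff R.neg intertwine translation uminus_matrix_vector_mult)
  with R show ?thesis
    unfolding mem_isometry_orbit_iff by blast
qed

text \<open>\<open>D\<close> is the component of \<open>C\<close> orthogonal to the range of \<open>Q\<close>; for skew \<open>Q\<close> this orthogonal complement is
  the kernel. The norm bound is the Cauchy--Schwarz inequality for \<open>D \<bullet> (Q x + C) = (norm D)\<^sup>2\<close>.\<close>

lemma killing_field_decomposition:
  fixes Q :: "real^'n^'n"
  assumes Q: "transpose Q = - Q"
  obtains v D where "C = Q *v v + D" "Q *v D = 0" "\<And>x. norm D \<le> norm (Q *v x + C)"
proof -
  have "subspace (range ((*v) Q))"
    by (intro linear_subspace_image matrix_vector_mul_linear subspace_UNIV)
  then have span: "span (range ((*v) Q)) = range ((*v) Q)"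
    by (simp add: span_eq_iff)
  obtain y D where y: "y \<in> span (range ((*v) Q))"
    and D: "\<And>w. w \<in> span (range ((*v) Q)) \<Longrightarrow> orthogonal D w" and C: "C = y + D"
    using orthogonal_subspace_decomp_exists[of "range ((*v) Q)" C] by metis
  obtain v where v: "y = Q *v v"
    using y span by auto
  have D_orth: "D \<bullet> (Q *v x) = 0" for x
    using D[of "Q *v x"] span by (auto simp: orthogonal_def)
  show ?thesis
  proof (rule that[of v D])
    show "C = Q *v v + D"
      using C v by simp
    have "(Q *v D) \<bullet> (Q *v D) = 0"
      using skew_matrix_inner[OF Q, of D "Q *v D"] D_orth by simp
    then show "Q *v D = 0"
      by simp
    fix x
    have "(norm D)\<^sup>2 = D \<bullet> (Q *v x + C)"
      by (simp add: C v inner_add_right D_orth power2_norm_eq_inner)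
    also have "\<dots> \<le> norm D * norm (Q *v x + C)"
      by (rule norm_cauchy_schwarz)
    finally show "norm D \<le> norm (Q *v x + C)"
      by (cases "D = 0") (simp_all add: power2_eq_square)
  qed
qed

text \<open>In the case of a nonzero constant part the normal basis is chosen in the hyperplane orthogonal to it,
  which costs one dimension; this accounts for the two values of \<open>k\<close>.\<close>

lemma admissible_field_normal_form:
  assumes W: "W \<in> (admissible_fields :: (real^'n \<Rightarrow> real^'n) set)"
  obtains k c s where "0 \<le> s" "s < 1" "k = (if s = 0 then CARD('n) div 2 else (CARD('n) - 1) div 2)"
    "nonneg_decreasing_on {1..k} c" "W \<in> isometry_orbit (block_field e k c s)"
proof -
  obtain Q C x0 where Q: "transpose Q = - Q" and W_eq: "W = (\<lambda>x. Q *v x + C)" and x0: "norm (W x0) < 1"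
    using W unfolding admissible_fields_def killing_fields_def by blast
  obtain v D where D: "C = Q *v v + D" "Q *v D = 0" "\<And>x. norm D \<le> norm (Q *v x + C)"
    using killing_field_decomposition[OF Q] by blast
  have D1: "norm D < 1"
    using D(3)[of x0] x0 by (simp add: W_eq)
  have W_eq': "W = (\<lambda>x. Q *v (x + v) + D)"
    unfolding W_eq D(1) by (simp add: matrix_vector_right_distrib add.assoc)
  note skew = skew_matrix_inner[OF Q]
  show ?thesis
  proof (cases "D = 0")
    case True
    let ?k = "CARD('n) div 2"
    obtain b c where
      orth: "\<forall>p\<in>{1..CARD('n)}. \<forall>q\<in>{1..CARD('n)}. b p \<bullet> b q = (if p = q then 1 else 0)"
      and c: "nonneg_decreasing_on {1..?k} c"
      and pairs: "\<forall>l\<in>{1..?k}. Q *v b (2 * l - 1) = c l *\<^sub>R b (2 * l) \<and> Q *v b (2 * l) = - c l *\<^sub>R b (2 * l - 1)"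
      and last: "odd CARD('n) \<longrightarrow> Q *v b CARD('n) = 0"
      using skew_normal_basis[OF matrix_vector_mul_linear[of Q] skew subspace_UNIV] by auto
    have "(\<lambda>x. Q *v (x + v) + 0 *\<^sub>R b CARD('n)) \<in> isometry_orbit (block_field e ?k c 0)"
    proof (rule normal_basis_in_orbit[OF _ Q])
      fix p assume p: "p \<in> {2 * ?k + 1..CARD('n)}"
      then have "2 * (CARD('n) div 2) + 1 \<le> p" "p \<le> CARD('n)"
        by auto
      then have "odd CARD('n)" "p = CARD('n)"
        by presburger+
      then show "Q *v b p = 0"
        using last by simp
    qed (use orth pairs in auto)
    then show ?thesis
      using that[of 0 ?k c] c True by (simp add: W_eq')
  next
    case False
    define w where "w = D /\<^sub>R norm D"
    have w: "w \<bullet> w = 1" "Q *v w = 0" "D = norm D *\<^sub>R w"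
      using False D(2) by (simp_all add: w_def dot_square_norm power2_eq_square matrix_vector_mult_scaleR)
    define S where "S = {y \<in> UNIV. \<forall>x\<in>span {w}. orthogonal x y}"
    have S_iff: "y \<in> S \<longleftrightarrow> w \<bullet> y = 0" for y
      by (auto simp: S_def orthogonal_def span_singleton)
    have "dim S + dim (span {w}) = dim (UNIV :: (real^'n) set)"
      unfolding S_def by (rule dim_subspace_orthogonal_to_vectors) auto
    moreover have "dim (span {w}) = 1"
      using w(1) by (auto simp: dim_insert)
    ultimately have dim_S: "dim S = CARD('n) - 1"
      by simp
    have S: "subspace S" "(*v) Q ` S \<subseteq> S"
      using skew[of w] w(2) by (auto simp: subspace_def S_iff inner_add_right)
    let ?k = "(CARD('n) - 1) div 2"
    obtain b c where
      mem: "\<forall>p\<in>{1..CARD('n) - 1}. b p \<in> S"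
      and orth: "\<forall>p\<in>{1..CARD('n) - 1}. \<forall>q\<in>{1..CARD('n) - 1}. b p \<bullet> b q = (if p = q then 1 else 0)"
      and c: "nonneg_decreasing_on {1..?k} c"
      and pairs: "\<forall>l\<in>{1..?k}. Q *v b (2 * l - 1) = c l *\<^sub>R b (2 * l) \<and> Q *v b (2 * l) = - c l *\<^sub>R b (2 * l - 1)"
      and last: "odd (CARD('n) - 1) \<longrightarrow> Q *v b (CARD('n) - 1) = 0"
      using skew_normal_basis[OF matrix_vector_mul_linear[of Q] skew S] unfolding dim_S by auto
    define b' where "b' = b(CARD('n) := w)"
    have n: "0 < CARD('n)"
      by simp
    have not_last: "p \<noteq> CARD('n)" if "p \<in> {1..CARD('n) - 1}" for p
      using that n unfolding atLeastAtMost_iff by linarith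
    have b': "b' p = b p" if "p \<in> {1..CARD('n) - 1}" for p
      using not_last[OF that] by (simp add: b'_def)
    have w_orth: "w \<bullet> b p = 0" "b p \<bullet> w = 0" if "p \<in> {1..CARD('n) - 1}" for p
      using mem that S_iff by (auto simp: inner_commute)
    have "(\<lambda>x. Q *v (x + v) + norm D *\<^sub>R b' CARD('n)) \<in> isometry_orbit (block_field e ?k c (norm D))"
    proof (rule normal_basis_in_orbit[OF _ Q])
      show "2 * ?k \<le> CARD('n)"
        by simp
    next
      fix p q assume "p \<in> {1..CARD('n)}" "q \<in> {1..CARD('n)}"
      then have "p = CARD('n) \<or> p \<in> {1..CARD('n) - 1}" "q = CARD('n) \<or> q \<in> {1..CARD('n) - 1}"
        by auto
      then show "b' p \<bullet> b' q = (if p = q then 1 else 0)"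
        using orth w_orth w(1) b' not_last by (elim disjE) (auto simp: b'_def)
    next
      fix l assume l: "l \<in> {1..?k}"
      then have "2 * l - 1 \<in> {1..CARD('n) - 1}" "2 * l \<in> {1..CARD('n) - 1}"
        by auto
      then show "Q *v b' (2 * l - 1) = c l *\<^sub>R b' (2 * l)" "Q *v b' (2 * l) = - c l *\<^sub>R b' (2 * l - 1)"
        using pairs l b' by auto
    next
      fix p assume p: "p \<in> {2 * ?k + 1..CARD('n)}"
      show "Q *v b' p = 0"
      proof (cases "p = CARD('n)")
        case False
        then have "2 * ((CARD('n) - 1) div 2) + 1 \<le> p" "p < CARD('n)"
          using p by auto
        then have "odd (CARD('n) - 1)" "p = CARD('n) - 1"
          by presburger+
        moreover from this have "p \<in> {1..CARD('n) - 1}"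
          using odd_pos[of "CARD('n) - 1"] unfolding atLeastAtMost_iff by linarith
        ultimately show ?thesis
          using last b' by simp
      qed (simp add: b'_def w(2))
    qed
    moreover have "norm D *\<^sub>R b' CARD('n) = D"
      using w(3) by (simp add: b'_def)
    ultimately show ?thesis
      using that[of "norm D" ?k c] c False D1 by (simp add: W_eq')
  qed
qed

end

section \<open>The moduli spaces\<close>

text \<open>Being of length less than \<open>1\<close> everywhere is an orbit invariant, so a parametrization of all
  orbits restricts to one of the orbits of global fields.\<close>

lemma moduli_spaces_bij_betw:
  fixes N :: "'a \<Rightarrow> real^'n \<Rightarrow> real^'n"
  assumes admissible: "\<And>a. a \<in> P \<Longrightarrow> N a \<in> admissible_fields"
    and unique: "\<And>a a'. a \<in> P \<Longrightarrow> a' \<in> P \<Longrightarrow> N a' \<in> isometry_orbit (N a) \<Longrightarrow> a = a'"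
    and exhaustive: "\<And>W. W \<in> admissible_fields \<Longrightarrow> \<exists>a\<in>P. W \<in> isometry_orbit (N a)"
    and global: "\<And>a. a \<in> P \<Longrightarrow> (\<forall>x. norm (N a x) < 1) \<longleftrightarrow> a \<in> G"
    and "G \<subseteq> P"
  shows "bij_betw (\<lambda>a. isometry_orbit (N a)) P moduli_space \<and>
    bij_betw (\<lambda>a. isometry_orbit (N a)) G global_moduli_space"
proof
  have inj: "inj_on (\<lambda>a. isometry_orbit (N a)) P"
    using unique by (intro inj_onI) (metis isometry_orbit_eq_iff)
  have img: "(\<lambda>a. isometry_orbit (N a)) ` P = moduli_space"
  proof (intro equalityI subsetI)
    fix c :: "(real^'n \<Rightarrow> real^'n) set" assume "c \<in> moduli_space"
    then obtain W where W: "c = isometry_orbit W" "W \<in> admissible_fields"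
      unfolding moduli_space_def by blast
    then obtain a where "a \<in> P" "W \<in> isometry_orbit (N a)"
      using exhaustive by blast
    then show "c \<in> (\<lambda>a. isometry_orbit (N a)) ` P"
      using W isometry_orbit_eq_iff[of W "N a"] by blast
  qed (use admissible in \<open>auto simp: moduli_space_def\<close>)
  show "bij_betw (\<lambda>a. isometry_orbit (N a)) P moduli_space"
    using inj img by (simp add: bij_betw_def)
  have "global_moduli_space = (\<lambda>a. isometry_orbit (N a)) ` {a \<in> P. \<forall>x. norm (N a x) < 1}"
    unfolding global_moduli_space_def img[symmetric] using isometry_orbit_bounded_iff by auto
  also have "{a \<in> P. \<forall>x. norm (N a x) < 1} = G"
    using global \<open>G \<subseteq> P\<close> by blast
  finally show "bij_betw (\<lambda>a. isometry_orbit (N a)) G global_moduli_space"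
    using inj_on_subset[OF inj \<open>G \<subseteq> P\<close>] by (simp add: bij_betw_def)
qed

lemma nonneg_decreasing_on_cong:
  assumes "\<And>l. l \<in> I \<Longrightarrow> a l = b l"
  shows "nonneg_decreasing_on I a \<longleftrightarrow> nonneg_decreasing_on I b"
  using assms by (simp add: nonneg_decreasing_on_def monotone_on_def)

lemma shifted_ball: "(\<forall>l\<in>{2..m}. P l) \<longleftrightarrow> (\<forall>l\<in>{1..m - 1}. P (l + 1))" for m :: nat
proof -
  have shift: "{2..m} = (\<lambda>l. l + 1) ` {1..m - 1}"
    by (cases m) (auto simp: image_Suc_atLeastAtMost numeral_2_eq_2)
  show ?thesis
    unfolding shift by blast
qed

lemma nonneg_decreasing_on_shift:
  "nonneg_decreasing_on {2..m} a \<longleftrightarrow> nonneg_decreasing_on {1..m - 1} (\<lambda>l. a (l + 1))"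
  unfolding nonneg_decreasing_on_def monotone_on_def shifted_ball by simp

context
  fixes e :: "'n::finite \<Rightarrow> nat" and m :: nat
  assumes e: "bij_betw e UNIV {1..CARD('n)}"
begin

lemma affine_form_admissible: "a \<in> params_odd m \<Longrightarrow> affine_form e m a \<in> admissible_fields"
  unfolding affine_form_eq_block_field
  by (rule block_field_admissible[OF e]) (auto simp: params_odd_def)

lemma affine_form_unique:
  assumes m: "2 * (m - 1) < CARD('n)" and a: "a \<in> params_odd m" "a' \<in> params_odd m"
    and orbit: "affine_form e m a' \<in> isometry_orbit (affine_form e m a)"
  shows "a = a'"
proof (rule extensionalityI)
  show "a \<in> extensional {1..m}" "a' \<in> extensional {1..m}"
    using a by (auto simp: params_odd_def)
  note orbit = orbit[unfolded affine_form_eq_block_field]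
  have first: "a 1 = a' 1"
    by (rule block_field_orbit_constant_unique[OF e orbit]) (use m a in \<open>auto simp: params_odd_def\<close>)
  have "a (l + 1) = a' (l + 1)" if "l \<in> {1..m - 1}" for l
    by (rule block_field_orbit_coeffs_unique[OF e _ _ _ orbit that])
      (use m a in \<open>auto simp: params_odd_def nonneg_decreasing_on_shift\<close>)
  then have "\<forall>l\<in>{2..m}. a l = a' l"
    unfolding shifted_ball by blast
  then show "a l = a' l" if "l \<in> {1..m}" for l
    using first that by (cases "l = 1") auto
qed

lemma affine_form_bounded_iff:
  assumes m: "2 * (m - 1) \<le> CARD('n)" and a: "a \<in> params_odd m"
  shows "(\<forall>x. norm (affine_form e m a x) < 1) \<longleftrightarrow> a \<in> global_params_odd m"
proof -
  have "(\<forall>x. norm (affine_form e m a x) < 1) \<longleftrightarrow> (\<forall>l\<in>{1..m - 1}. a (l + 1) = 0)"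
    unfolding affine_form_eq_block_field
    by (rule block_field_bounded_iff[OF e m]) (use a in \<open>auto simp: params_odd_def\<close>)
  then show ?thesis
    using a unfolding global_params_odd_def params_odd_def shifted_ball by blast
qed

text \<open>The parameter vector carries \<open>s\<close> in front and the block coefficients, shifted by one, behind it; it
  is truncated to be a vector of \<open>\<real>\<^sup>m\<close>.\<close>

lemma affine_form_realizes:
  assumes m: "1 \<le> m" and s: "0 \<le> s" "s < 1" and c: "nonneg_decreasing_on {1..m - 1} c"
  obtains a where "a \<in> params_odd m" "a 1 = s" "affine_form e m a = block_field e (m - 1) c s"
proof -
  define a where "a = restrict (\<lambda>l. if l = 1 then s else c (l - 1)) {1..m}"
  have a1: "a 1 = s"
    using m by (simp add: a_def)
  have shift: "a (l + 1) = c l" if "l \<in> {1..m - 1}" for l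
    using that by (auto simp: a_def)
  have "nonneg_decreasing_on {1..m - 1} (\<lambda>l. a (l + 1))"
    using c nonneg_decreasing_on_cong[of "{1..m - 1}" "\<lambda>l. a (l + 1)" c] shift by blast
  then have "a \<in> params_odd m"
    using s a1 unfolding params_odd_def nonneg_decreasing_on_shift by (auto simp: a_def)
  moreover have "affine_form e m a = block_field e (m - 1) c s"
    unfolding affine_form_eq_block_field a1 by (rule block_field_cong) (rule shift)
  ultimately show ?thesis
    using that a1 by blast
qed

text \<open>Here \<open>n div 2 = (n - 1) div 2\<close>, so fields with and without a constant part have the same number of
  blocks, and \<open>a 1 = 0\<close> is allowed.\<close>

lemma moduli_odd:
  assumes n: "odd CARD('n)" and m: "m = (CARD('n) + 1) div 2"
  shows "bij_betw (\<lambda>a. isometry_orbit (affine_form e m a)) (params_odd m)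
      (moduli_space :: (real^'n \<Rightarrow> real^'n) set set) \<and>
    bij_betw (\<lambda>a. isometry_orbit (affine_form e m a)) (global_params_odd m)
      (global_moduli_space :: (real^'n \<Rightarrow> real^'n) set set)"
proof (rule moduli_spaces_bij_betw)
  have m': "2 * (m - 1) < CARD('n)" "CARD('n) div 2 = m - 1" "(CARD('n) - 1) div 2 = m - 1" "1 \<le> m"
    using n m by (auto elim!: oddE)
  fix a a' assume a: "a \<in> params_odd m"
  show "affine_form e m a \<in> admissible_fields"
    using a by (rule affine_form_admissible)
  show "(\<forall>x. norm (affine_form e m a x) < 1) \<longleftrightarrow> a \<in> global_params_odd m"
    using m' a by (intro affine_form_bounded_iff) simp_all
  assume "a' \<in> params_odd m" "affine_form e m a' \<in> isometry_orbit (affine_form e m a)"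
  then show "a = a'"
    by (rule affine_form_unique[OF m'(1) a])
next
  have m': "CARD('n) div 2 = m - 1" "(CARD('n) - 1) div 2 = m - 1" "1 \<le> m"
    using n m by (auto elim!: oddE)
  fix W assume "W \<in> (admissible_fields :: (real^'n \<Rightarrow> real^'n) set)"
  then obtain k c s where s: "0 \<le> s" "s < 1" and k: "k = m - 1"
    and c: "nonneg_decreasing_on {1..k} c" and W: "W \<in> isometry_orbit (block_field e k c s)"
    by (rule admissible_field_normal_form[OF e, unfolded m' if_cancel])
  from s c show "\<exists>a\<in>params_odd m. W \<in> isometry_orbit (affine_form e m a)"
    using affine_form_realizes[OF m'(3), of s c] W unfolding k by metis
next
  show "global_params_odd m \<subseteq> params_odd m"
    by (auto simp: global_params_odd_def params_odd_def nonneg_decreasing_on_def monotone_on_def)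
qed

text \<open>The second part of the parameter space is the odd-type parameter set with \<open>a 1 = 0\<close> removed; the fields
  without constant part have one more block available and form the first part.\<close>

lemma moduli_even:
  assumes n: "even CARD('n)" and m: "m = CARD('n) div 2"
  shows "bij_betw (\<lambda>a. isometry_orbit (normal_form_even e m a)) (params_even m)
      (moduli_space :: (real^'n \<Rightarrow> real^'n) set set) \<and>
    bij_betw (\<lambda>a. isometry_orbit (normal_form_even e m a)) (global_params_even m)
      (global_moduli_space :: (real^'n \<Rightarrow> real^'n) set set)"
proof (rule moduli_spaces_bij_betw)
  have m': "2 * m = CARD('n)" "2 * (m - 1) < CARD('n)" "2 * (m - 1) \<le> CARD('n)"
    "(CARD('n) - 1) div 2 = m - 1" "1 \<le> m"
  proof -
    show "2 * m = CARD('n)"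
      using n m by simp
    moreover have "0 < CARD('n)"
      by simp
    ultimately show "2 * (m - 1) < CARD('n)" "2 * (m - 1) \<le> CARD('n)"
        "(CARD('n) - 1) div 2 = m - 1" "1 \<le> m"
      by linarith+
  qed
  let ?L = "{a \<in> extensional {1..m}. nonneg_decreasing_on {1..m} a}"
  let ?A = "{a \<in> params_odd m. 0 < a 1}"
  have params: "params_even m = ?L <+> ?A"
    by (auto simp: params_even_def params_odd_def)
  have global_params: "global_params_even m =
      {a \<in> extensional {1..m}. \<forall>l\<in>{1..m}. a l = 0} <+> {a \<in> global_params_odd m. 0 < a 1}"
    by (auto simp: global_params_even_def global_params_odd_def)
  have form: "normal_form_even e m (Inl a) = block_field e m a 0"
    "normal_form_even e m (Inr a) = affine_form e m a" for a
    by (simp_all add: normal_form_even_def linear_form_eq_block_field)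
  fix a a' assume a: "a \<in> params_even m"
  show "normal_form_even e m a \<in> admissible_fields"
    using a block_field_admissible[OF e, of 0] affine_form_admissible by (auto simp: params form)
  show "(\<forall>x. norm (normal_form_even e m a x) < 1) \<longleftrightarrow> a \<in> global_params_even m"
  proof (cases a)
    case (Inl f)
    then show ?thesis
      using a block_field_bounded_iff[OF e, of m 0 f] m'(1) by (auto simp: form params global_params)
  next
    case (Inr f)
    then show ?thesis
      using a affine_form_bounded_iff[OF m'(3), of f] by (auto simp: form params global_params)
  qed
  \<comment> \<open>Linear and affine forms have different constant terms, which is an orbit invariant.\<close>
  have mixed: False if "f' \<in> ?A"
    "affine_form e m f' \<in> isometry_orbit (block_field e m f 0)" for f f'
    using block_field_orbit_constant_unique[OF e that(2)[unfolded affine_form_eq_block_field]] that(1) m'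
    by (simp add: params_odd_def)
  assume a': "a' \<in> params_even m" and orbit: "normal_form_even e m a' \<in> isometry_orbit (normal_form_even e m a)"
  show "a = a'"
  proof (cases a; cases a')
    fix f f' assume [simp]: "a = Inl f" "a' = Inl f'"
    have "f = f'"
    proof (rule extensionalityI)
      show "f \<in> extensional {1..m}" "f' \<in> extensional {1..m}"
        using a a' by (auto simp: params)
      show "f l = f' l" if "l \<in> {1..m}" for l
        by (rule block_field_orbit_coeffs_unique[OF e _ _ _ orbit[simplified, unfolded form] that])
          (use a a' m' in \<open>auto simp: params\<close>)
    qed
    then show ?thesis
      by simp
  next
    fix f f' assume "a = Inr f" "a' = Inr f'"
    then show ?thesis
      using affine_form_unique[OF m'(2), of f f'] a a' orbit by (auto simp: params form)
  next
    fix f f' assume "a = Inl f" "a' = Inr f'"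
    then show ?thesis
      using mixed[of f' f] a' orbit by (auto simp: params form)
  next
    fix f f' assume "a = Inr f" "a' = Inl f'"
    then show ?thesis
      using mixed[of f f'] a isometry_orbit_sym[OF orbit] by (auto simp: params form)
  qed
next
  have "0 < CARD('n)" "2 * m = CARD('n)"
    using n m by simp_all
  then have m': "(CARD('n) - 1) div 2 = m - 1" "1 \<le> m"
    by linarith+
  fix W assume "W \<in> (admissible_fields :: (real^'n \<Rightarrow> real^'n) set)"
  then obtain k c s where s: "0 \<le> s" "s < 1" and k: "k = (if s = 0 then m else m - 1)"
    and c: "nonneg_decreasing_on {1..k} c" and W: "W \<in> isometry_orbit (block_field e k c s)"
    by (rule admissible_field_normal_form[OF e, unfolded m'(1) m[symmetric]])
  show "\<exists>a\<in>params_even m. W \<in> isometry_orbit (normal_form_even e m a)"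
  proof (cases "s = 0")
    case True
    let ?a = "restrict c {1..m}"
    have "nonneg_decreasing_on {1..m} ?a"
      using c k True nonneg_decreasing_on_cong[of "{1..m}" ?a c] by simp
    then have "Inl ?a \<in> params_even m"
      by (auto simp: params_even_def)
    moreover have "normal_form_even e m (Inl ?a) = block_field e k c s"
      using k True by (auto simp: normal_form_even_def linear_form_eq_block_field intro: block_field_cong)
    ultimately show ?thesis
      using W by metis
  next
    case False
    then obtain a where a: "a \<in> params_odd m" "a 1 = s" "affine_form e m a = block_field e k c s"
      using affine_form_realizes[OF m'(2) s, of c] c k by auto
    then have "Inr a \<in> params_even m"
      using False by (auto simp: params_even_def params_odd_def)
    moreover have "normal_form_even e m (Inr a) = block_field e k c s"
      using a by (simp add: normal_form_even_def)
    ultimately show ?thesis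
      using W by metis
  qed
next
  show "global_params_even m \<subseteq> params_even m"
    by (auto simp: global_params_even_def params_even_def nonneg_decreasing_on_def monotone_on_def)
qed

end

theorem proposition9:
  fixes e :: "'n::finite \<Rightarrow> nat"
  assumes "CARD('n) \<ge> 2"
    and "bij_betw e UNIV {1..CARD('n)}"
  shows "(even CARD('n) \<longrightarrow> (\<forall>m. m = CARD('n) div 2 \<longrightarrow>
            bij_betw (\<lambda>a. isometry_orbit (normal_form_even e m a))
              (params_even m) (moduli_space :: (real^'n \<Rightarrow> real^'n) set set) \<and>
            bij_betw (\<lambda>a. isometry_orbit (normal_form_even e m a))
              (global_params_even m) (global_moduli_space :: (real^'n \<Rightarrow> real^'n) set set))) \<and>
         (odd CARD('n) \<longrightarrow> (\<forall>m. m = (CARD('n) + 1) div 2 \<longrightarrow>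
            bij_betw (\<lambda>a. isometry_orbit (affine_form e m a))
              (params_odd m) (moduli_space :: (real^'n \<Rightarrow> real^'n) set set) \<and>
            bij_betw (\<lambda>a. isometry_orbit (affine_form e m a))
              (global_params_odd m) (global_moduli_space :: (real^'n \<Rightarrow> real^'n) set set)))"
  using moduli_even[OF assms(2)] moduli_odd[OF assms(2)] by blast

end
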